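(* Let $F,\phi:\mathcal X\to\mathbb R\cup\{+\infty\}$ be proper lower semicontinuous functions such that $\inf_{x\in\mathcal X}(F+\phi)(x)>-\infty$; $F$ is locally Lipschitz continuous at every point of $\operatorname{int}(\operatorname{dom}F)$; $\operatorname{dom}F$ is convex with $\operatorname{dom}\phi\subset\operatorname{int}(\operatorname{dom}F)$; and $\phi$ is prox-bounded with threshold $\gamma_\phi\in(0,+\infty]$. Assume moreover that $F$ is differentiable over $\operatorname{int}(\operatorname{dom}F)$ and that $\nabla F:\operatorname{int}(\operatorname{dom}F)\to\mathcal X$ is locally Lipschitz continuous at every point of $\operatorname{int}(\operatorname{dom}F)$. Choose $\widetilde\gamma\in(0,\gamma_\phi)$ arbitrarily. For $x^\star\in\operatorname{dom}\phi$, the following conditions are equivalent: (i) $x^\star$ is a proximal stationary point of $F+\phi$. (ii) There exist $(x_n)_{n=1}^\infty\subset\operatorname{int}(\operatorname{dom}F)$ with $\lim_{n\to\infty}x_n=x^\star$ and $(\gamma_n)_{n=1}^\infty\subset[\gamma_{\rm low},\widetilde\gamma]$ with some $\gamma_{\rm low}\in(0,\widetilde\gamma]$ such that $\liminf_{n\to\infty}\mathcal M_{\gamma_n}^{F,\phi}(x_n)=0$.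
   Context: $\mathcal X$ is a (finite-dimensional real) Euclidean space with inner product $\langle\cdot,\cdot\rangle$ and norm $\|\cdot\|$; $B(\bar x,\delta)$ is the open ball; $\operatorname{dom}\psi=\{x:\psi(x)<+\infty\}$; proper means $\operatorname{dom}\psi\neq\emptyset$. A function (or mapping) is locally Lipschitz continuous at $\bar x$ if it is Lipschitz continuous on some open neighborhood of $\bar x$. $\phi$ is prox-bounded with threshold $\gamma_\phi\in(0,+\infty]$ if $\phi+\frac1{2\gamma}\|\cdot\|^2$ is bounded below for all $\gamma\in(0,\gamma_\phi)$. Subdifferentials of $\psi:\mathcal X\to\mathbb R\cup\{+\infty\}$ at $\bar x\in\operatorname{dom}\psi$ (all are empty if $\bar x\notin\operatorname{dom}\psi$): - proximal: $v\in\partial_{\rm P}\psi(\bar x)$ if there are $\gamma,\delta>0$ with $\psi(x)\ge\psi(\bar x)+\langle v,x-\bar x\rangle-\frac1{2\gamma}\|x-\bar x\|^2$ for all $x\in B(\bar x,\delta)$; - Fréchet: $v\in\partial_{\rm F}\psi(\bar x)$ if $\liminf_{x\to\bar x,\,x\ne\bar x}\frac{\psi(x)-\psi(\bar x)-\langle v,x-\bar x\rangle}{\|x-\bar x\|}\ge0$; - limiting: $v\in\partial_{\rm L}\psi(\bar x)$ if there are $x_n\to\bar x$ with $\psi(x_n)\to\psi(\bar x)$ and $v_n\in\partial_{\rm F}\psi(x_n)$ with $v_n\to v$. $x^\star\in\operatorname{dom}\phi$ is a proximal stationary point of $F+\phi$ if $0\in\partial_{\rm P}(F+\phi)(x^\star)$.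 For $\gamma>0$, $\operatorname{prox}_{\gamma\phi}(\bar x)=\operatorname{argmin}_{x\in\mathcal X}\big(\phi(x)+\frac1{2\gamma}\|x-\bar x\|^2\big)$ (a set), and $$\mathcal M_\gamma^{F,\phi}(\bar x)=\inf\Big\{\Big\|\frac{\bar x-p}{\gamma}\Big\| : p\in\operatorname{prox}_{\gamma\phi}(\bar x-\gamma v),\ v\in\partial_{\rm L}F(\bar x)\Big\}\in[0,+\infty]\quad(\inf\emptyset=+\infty).$$ (For $F$ differentiable with locally Lipschitz gradient near $\bar x$, $\partial_{\rm L}F(\bar x)=\{\nabla F(\bar x)\}$.) *)

theory Defs
  imports "HOL-Analysis.Analysis"
begin

text \<open>
  Functions into \<open>\<real> \<union> {+\<infinity>}\<close> are modelled as functions into \<^typ>\<open>ereal\<close> that never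
  take the value \<open>-\<infinity>\<close>; the latter is part of properness below.
\<close>

definition eff_dom :: "('a \<Rightarrow> ereal) \<Rightarrow> 'a set" where
  "eff_dom f = {x. f x < \<infinity>}"

definition proper_fun :: "('a \<Rightarrow> ereal) \<Rightarrow> bool" where
  "proper_fun f \<longleftrightarrow> (\<forall>x. f x \<noteq> -\<infinity>) \<and> eff_dom f \<noteq> {}"

definition lower_semicontinuous :: "('a::topological_space \<Rightarrow> ereal) \<Rightarrow> bool" where
  "lower_semicontinuous f \<longleftrightarrow> (\<forall>x. f x \<le> Liminf (at x) f)"

text \<open>
  \<open>S\<close> is the set on which \<open>f\<close> is regarded as defined: the neighbourhood has to lie in \<open>S\<close>,
  so that values of the total function \<open>f\<close> outside \<open>S\<close> are irrelevant.
\<close>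

definition locally_lipschitz_at ::
    "'a::metric_space set \<Rightarrow> ('a \<Rightarrow> 'b::metric_space) \<Rightarrow> 'a \<Rightarrow> bool" where
  "locally_lipschitz_at S f x \<longleftrightarrow>
     (\<exists>U L. open U \<and> x \<in> U \<and> U \<subseteq> S \<and> L-lipschitz_on U f)"

text \<open>
  The gradient is only meaningful at interior points of the effective domain at which the
  finite part \<open>\<lambda>y. real_of_ereal (f y)\<close> is differentiable.
\<close>

definition gradient :: "('a::real_inner \<Rightarrow> ereal) \<Rightarrow> 'a \<Rightarrow> 'a" where
  "gradient f x = (THE g. GDERIV (\<lambda>y. real_of_ereal (f y)) x :> g)"

text \<open>
  A threshold in this sense need not be the largest one: \<open>\<gamma>\<^sub>\<phi>\<close> may be decreased freely.
\<close>

definition prox_bounded :: "('a::real_normed_vector \<Rightarrow> ereal) \<Rightarrow> ereal \<Rightarrow> bool" where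
  "prox_bounded \<phi> \<gamma>\<^sub>\<phi> \<longleftrightarrow>
     0 < \<gamma>\<^sub>\<phi> \<and>
     (\<forall>\<gamma>::real. 0 < \<gamma> \<longrightarrow> ereal \<gamma> < \<gamma>\<^sub>\<phi> \<longrightarrow>
        (\<exists>m::real. \<forall>x. ereal m \<le> \<phi> x + ereal (1 / (2 * \<gamma>) * (norm x)\<^sup>2)))"

definition prox_subdiff :: "('a::real_inner \<Rightarrow> ereal) \<Rightarrow> 'a \<Rightarrow> 'a set" where
  "prox_subdiff \<psi> xb = {v. xb \<in> eff_dom \<psi> \<and>
     (\<exists>\<gamma>>0. \<exists>\<delta>>0. \<forall>x\<in>ball xb \<delta>.
        \<psi> x \<ge> \<psi> xb + ereal (v \<bullet> (x - xb)) - ereal (1 / (2 * \<gamma>) * (norm (x - xb))\<^sup>2))}"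

definition frechet_subdiff :: "('a::real_inner \<Rightarrow> ereal) \<Rightarrow> 'a \<Rightarrow> 'a set" where
  "frechet_subdiff \<psi> xb = {v. xb \<in> eff_dom \<psi> \<and>
     Liminf (at xb) (\<lambda>x. (\<psi> x - \<psi> xb - ereal (v \<bullet> (x - xb))) / ereal (norm (x - xb))) \<ge> 0}"

definition limiting_subdiff :: "('a::real_inner \<Rightarrow> ereal) \<Rightarrow> 'a \<Rightarrow> 'a set" where
  "limiting_subdiff \<psi> xb = {v. xb \<in> eff_dom \<psi> \<and>
     (\<exists>xs vs. xs \<longlonglongrightarrow> xb \<and> (\<lambda>n. \<psi> (xs n)) \<longlonglongrightarrow> \<psi> xb \<and>
        (\<forall>n. vs n \<in> frechet_subdiff \<psi> (xs n)) \<and> vs \<longlonglongrightarrow> v)}"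

definition prox_stationary ::
    "('a::real_inner \<Rightarrow> ereal) \<Rightarrow> ('a \<Rightarrow> ereal) \<Rightarrow> 'a \<Rightarrow> bool" where
  "prox_stationary F \<phi> x \<longleftrightarrow> x \<in> eff_dom \<phi> \<and> 0 \<in> prox_subdiff (\<lambda>y. F y + \<phi> y) x"

definition prox :: "real \<Rightarrow> ('a::real_normed_vector \<Rightarrow> ereal) \<Rightarrow> 'a \<Rightarrow> 'a set" where
  "prox \<gamma> \<phi> xb =
     {p. is_arg_min (\<lambda>x. \<phi> x + ereal (1 / (2 * \<gamma>) * (norm (x - xb))\<^sup>2)) (\<lambda>x. True) p}"

text \<open>The infimum is taken in \<^typ>\<open>ereal\<close>, so it is \<open>+\<infinity>\<close> over the empty set.\<close>

definition residual ::
    "('a::real_inner \<Rightarrow> ereal) \<Rightarrow> ('a \<Rightarrow> ereal) \<Rightarrow> real \<Rightarrow> 'a \<Rightarrow> ereal" where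
  "residual F \<phi> \<gamma> xb =
     Inf {ereal (norm ((xb - p) /\<^sub>R \<gamma>)) | p v.
            v \<in> limiting_subdiff F xb \<and> p \<in> prox \<gamma> \<phi> (xb - \<gamma> *\<^sub>R v)}"

end

(*
  Near a point of the interior of dom F the first-order expansion of F has a quadratic error,
  so the quadratic term in the definition of proximal stationarity absorbs it: x is proximally
  stationary for F + phi iff phi has, near x, a quadratic minorant touching at x with slope
  -grad F(x).  Prox-boundedness makes this minorant global once the step size is small, and then
  x lies in prox(x - gamma grad F(x)), so the constant sequence at x has zero residual.
  Conversely, a vanishing lower limit of the residuals gives proximal points p_k -> x, and lower
  semicontinuity of phi carries their proximal inequalities over to x.
*)

theory Submission
  imports Defs
begin

section \<open>Finite values, gradients and the quadratic expansion error\<close>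

lemma eff_dom_ereal_real:
  assumes "proper_fun f" "x \<in> eff_dom f"
  shows "f x = ereal (real_of_ereal (f x))"
  using assms by (cases "f x") (auto simp: proper_fun_def eff_dom_def)

lemma not_in_eff_dom: "x \<notin> eff_dom f \<longleftrightarrow> f x = \<infinity>"
  by (auto simp: eff_dom_def)

text \<open>Riesz representation in coordinates: a linear functional is the inner product with the
  vector whose coordinates are its values on the orthonormal basis.\<close>

lemma differentiable_imp_GDERIV:
  fixes f :: "'a::euclidean_space \<Rightarrow> real"
  assumes "f differentiable (at x)"
  shows "\<exists>g. GDERIV f x :> g"
proof -
  obtain f' where f': "(f has_derivative f') (at x)"
    using assms by (auto simp: differentiable_def)
  interpret bounded_linear f' using f' by (rule has_derivative_bounded_linear)
  have "f' h = h \<bullet> (\<Sum>b\<in>Basis. f' b *\<^sub>R b)" for h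
  proof -
    have "f' h = f' (\<Sum>b\<in>Basis. (h \<bullet> b) *\<^sub>R b)"
      by (simp add: euclidean_representation)
    also have "\<dots> = h \<bullet> (\<Sum>b\<in>Basis. f' b *\<^sub>R b)"
      by (simp add: sum scaleR inner_sum_right mult.commute)
    finally show ?thesis .
  qed
  then have "f' = (\<lambda>h. h \<bullet> (\<Sum>b\<in>Basis. f' b *\<^sub>R b))" by blast
  then show ?thesis using f' unfolding gderiv_def by metis
qed

lemma GDERIV_unique:
  assumes "GDERIV f x :> a" "GDERIV f x :> b"
  shows "a = b"
proof -
  have "(\<lambda>h. inner h a) = (\<lambda>h. inner h b)"
    using assms unfolding gderiv_def by (rule has_derivative_unique)
  then have "inner (a - b) a = inner (a - b) b" by metis
  then have "inner (a - b) (a - b) = 0" by (simp add: inner_diff_right)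
  then show ?thesis by simp
qed

text \<open>Existence and uniqueness of the representing vector make the definite description in
  \<open>gradient\<close> well defined.\<close>

lemma GDERIV_gradient:
  fixes F :: "'a::euclidean_space \<Rightarrow> ereal"
  assumes "(\<lambda>y. real_of_ereal (F y)) differentiable (at x)"
  shows "GDERIV (\<lambda>y. real_of_ereal (F y)) x :> gradient F x"
proof -
  obtain g where "GDERIV (\<lambda>y. real_of_ereal (F y)) x :> g"
    using differentiable_imp_GDERIV[OF assms] by blast
  then show ?thesis
    unfolding gradient_def by (rule theI) (rule GDERIV_unique[OF _ \<open>GDERIV _ x :> g\<close>])
qed

lemma GDERIV_eventually_le:
  assumes "GDERIV f x :> g" "0 < e"
  shows "eventually (\<lambda>y. \<bar>f y - f x - g \<bullet> (y - x)\<bar> \<le> e * norm (y - x)) (at x)"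
  using assms unfolding gderiv_def has_derivative_within_alt2
  by (auto simp: inner_commute)

text \<open>A two-sided form of the descent lemma: the mean value inequality is applied to the error
  of the linearization, whose derivative at distance d from \<open>x\<close> has norm at most a
  Lipschitz constant times d. The factor 1/2 of the sharp bound is given up, since only some
  constant is needed.\<close>

lemma GDERIV_lipschitz_quadratic_bound:
  fixes f :: "'a::euclidean_space \<Rightarrow> real"
  assumes deriv: "\<And>z. z \<in> D \<Longrightarrow> GDERIV f z :> g z"
    and lip: "locally_lipschitz_at D g x"
  obtains L \<delta> where "L > 0" "\<delta> > 0" "ball x \<delta> \<subseteq> D"
    "\<And>y. y \<in> ball x \<delta> \<Longrightarrow> \<bar>f y - f x - g x \<bullet> (y - x)\<bar> \<le> L * (norm (y - x))\<^sup>2"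
proof -
  obtain U L where U: "open U" "x \<in> U" "U \<subseteq> D" "L-lipschitz_on U g"
    using lip unfolding locally_lipschitz_at_def by blast
  obtain \<delta> where \<delta>: "\<delta> > 0" "ball x \<delta> \<subseteq> U"
    using U open_contains_ball by metis
  have L: "L \<ge> 0" using U(4) by (rule lipschitz_on_nonneg)
  have bound: "\<bar>f y - f x - g x \<bullet> (y - x)\<bar> \<le> (L + 1) * (norm (y - x))\<^sup>2"
    if y: "y \<in> ball x \<delta>" for y
  proof -
    \<comment> \<open>This ball contains the segment from \<open>x\<close> to \<open>y\<close> and
      still lies inside \<open>ball x \<delta>\<close>, hence inside \<open>U\<close>.\<close>
    define S where "S = cball x (norm (y - x))"
    have SU: "S \<subseteq> U"
      using y \<delta> unfolding S_def by (auto simp: dist_norm norm_minus_commute subset_iff)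
    have "norm (f y - f x - (y - x) \<bullet> g x) \<le> norm (y - x) * (L * norm (y - x))"
    proof (rule differentiable_bound_linearization[where S = S and f' = "\<lambda>z h. h \<bullet> g z"])
      show "x + t *\<^sub>R (y - x) \<in> S" if "t \<in> {0..1}" for t
        using that by (auto simp: S_def dist_norm mult_left_le_one_le)
      show "(f has_derivative (\<lambda>h. h \<bullet> g z)) (at z within S)" if "z \<in> S" for z
        using deriv[of z] that SU U(3) unfolding gderiv_def
        by (blast intro: has_derivative_at_withinI)
      show "onorm ((\<lambda>h. h \<bullet> g z) - (\<lambda>h. h \<bullet> g x)) \<le> L * norm (y - x)" if "z \<in> S" for z
      proof (rule onorm_le)
        fix h
        have "dist (g z) (g x) \<le> L * dist z x"
          using U(4) that SU U(2) by (intro lipschitz_onD) auto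
        also have "\<dots> \<le> L * norm (y - x)"
          using that L unfolding S_def by (intro mult_left_mono) (auto simp: dist_commute)
        finally have *: "norm (g z - g x) \<le> L * norm (y - x)" by (simp add: dist_norm)
        have "\<bar>h \<bullet> (g z - g x)\<bar> \<le> norm h * norm (g z - g x)" by (rule Cauchy_Schwarz_ineq2)
        also have "\<dots> \<le> norm h * (L * norm (y - x))"
          using * by (intro mult_left_mono) auto
        finally show "norm (((\<lambda>h. h \<bullet> g z) - (\<lambda>h. h \<bullet> g x)) h) \<le> L * norm (y - x) * norm h"
          by (simp add: inner_diff_right mult_ac)
      qed
      show "x \<in> S" by (simp add: S_def)
    qed
    then have "\<bar>f y - f x - g x \<bullet> (y - x)\<bar> \<le> L * (norm (y - x))\<^sup>2"
      by (simp add: inner_commute power2_eq_square mult_ac)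
    \<comment> \<open>The Lipschitz constant may be 0; adding 1 makes the resulting constant
      strictly positive.\<close>
    also have "\<dots> \<le> (L + 1) * (norm (y - x))\<^sup>2" by (intro mult_right_mono) auto
    finally show ?thesis .
  qed
  show thesis
    by (rule that[of "L + 1" \<delta>]) (use L \<delta> U bound in auto)
qed

lemma locally_lipschitz_at_isCont:
  assumes "locally_lipschitz_at D g x"
  shows "isCont g x"
proof -
  obtain U L where "open U" "x \<in> U" "L-lipschitz_on U g"
    using assms unfolding locally_lipschitz_at_def by blast
  then show ?thesis
    using lipschitz_on_continuous_on continuous_on_eq_continuous_at by blast
qed

section \<open>Subdifferentials at points of differentiability\<close>

lemma frechet_quotient_ereal:
  fixes \<psi> :: "'a::euclidean_space \<Rightarrow> ereal"
  assumes "proper_fun \<psi>" "x \<in> interior (eff_dom \<psi>)"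
  shows "eventually (\<lambda>y. (\<psi> y - \<psi> x - ereal (v \<bullet> (y - x))) / ereal (norm (y - x)) =
    ereal ((real_of_ereal (\<psi> y) - real_of_ereal (\<psi> x) - v \<bullet> (y - x)) / norm (y - x))) (at x)"
proof -
  have "eventually (\<lambda>y. y \<in> interior (eff_dom \<psi>)) (at x)"
    using assms(2) by (intro eventually_at_in_open') auto
  then show ?thesis
    using eventually_neq_at_within[of x x UNIV]
  proof eventually_elim
    case (elim y)
    then have "y \<in> eff_dom \<psi>" "x \<in> eff_dom \<psi>" using assms(2) interior_subset by auto
    then obtain a b where "\<psi> y = ereal a" "\<psi> x = ereal b"
      using eff_dom_ereal_real[OF assms(1)] by blast
    then show ?case using elim by simp
  qed
qed

text \<open>For the gradient the quotient tends to 0. Any other \<open>v\<close> would make the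
  quotient stay clearly negative along the ray from \<open>x\<close> in the direction
  \<open>v - g\<close>.\<close>

lemma frechet_subdiff_eq_gradient:
  fixes \<psi> :: "'a::euclidean_space \<Rightarrow> ereal"
  assumes proper: "proper_fun \<psi>" and x: "x \<in> interior (eff_dom \<psi>)"
    and deriv: "GDERIV (\<lambda>y. real_of_ereal (\<psi> y)) x :> g"
  shows "frechet_subdiff \<psi> x = {g}"
proof -
  define f where "f = (\<lambda>y. real_of_ereal (\<psi> y))"
  have d: "GDERIV f x :> g" using deriv by (simp add: f_def)
  have xd: "x \<in> eff_dom \<psi>" using x interior_subset by auto
  have fr: "v \<in> frechet_subdiff \<psi> x \<longleftrightarrow>
      (\<forall>c<0. eventually (\<lambda>y. c < ereal ((f y - f x - v \<bullet> (y - x)) / norm (y - x))) (at x))" for v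
  proof -
    have "Liminf (at x) (\<lambda>y. (\<psi> y - \<psi> x - ereal (v \<bullet> (y - x))) / ereal (norm (y - x))) =
      Liminf (at x) (\<lambda>y. ereal ((f y - f x - v \<bullet> (y - x)) / norm (y - x)))"
      unfolding f_def by (rule Liminf_eq[OF frechet_quotient_ereal[OF proper x]])
    then show ?thesis unfolding frechet_subdiff_def using xd by (simp del: ereal_divide add: le_Liminf_iff[symmetric])
  qed
  have "g \<in> frechet_subdiff \<psi> x"
    unfolding fr
  proof (intro allI impI)
    fix c :: ereal assume "c < 0"
    \<comment> \<open>The level \<open>c\<close> may be -\<infinity>, so a real level between it and
      0 serves as the tolerance.\<close>
    then obtain r where r: "c < ereal r" "ereal r < 0" using ereal_dense2 by blast
    then have "eventually (\<lambda>y. \<bar>f y - f x - g \<bullet> (y - x)\<bar> \<le> - r * norm (y - x)) (at x)"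
      by (intro GDERIV_eventually_le[OF d]) auto
    then show "eventually (\<lambda>y. c < ereal ((f y - f x - g \<bullet> (y - x)) / norm (y - x))) (at x)"
      using eventually_neq_at_within[of x x UNIV]
    proof eventually_elim
      case (elim y)
      then have "r * norm (y - x) \<le> f y - f x - g \<bullet> (y - x)" by linarith
      then have "r \<le> (f y - f x - g \<bullet> (y - x)) / norm (y - x)"
        using elim by (simp add: pos_le_divide_eq)
      then show ?case using r(1) less_le_trans by fastforce
    qed
  qed
  moreover have "v = g" if v: "v \<in> frechet_subdiff \<psi> x" for v
  proof (rule ccontr)
    assume "v \<noteq> g"
    define w where "w = v - g"
    have w: "norm w > 0" using \<open>v \<noteq> g\<close> by (simp add: w_def)
    \<comment> \<open>The Frechet inequality and the first-order expansion each cost one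
      \<open>e\<close>; together they bound the slope along \<open>w\<close> by
      \<open>2 * e\<close>, which is below its true value \<open>norm w\<close>.\<close>
    define e where "e = norm w / 3"
    have e: "e > 0" using w by (simp add: e_def)
    have "ereal (- e) < 0" using e by simp
    then have "eventually (\<lambda>y. ereal (- e) < ereal ((f y - f x - v \<bullet> (y - x)) / norm (y - x))) (at x)"
      using v unfolding fr by blast
    then have "eventually (\<lambda>y. y \<noteq> x \<longrightarrow> w \<bullet> (y - x) \<le> 2 * e * norm (y - x)) (at x)"
      using GDERIV_eventually_le[OF d e]
    proof eventually_elim
      case (elim y)
      show ?case
      proof
        assume "y \<noteq> x"
        then have "- e * norm (y - x) < f y - f x - v \<bullet> (y - x)"
          using elim(1) by (simp add: pos_less_divide_eq)
        then show "w \<bullet> (y - x) \<le> 2 * e * norm (y - x)"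
          using elim(2) unfolding w_def inner_diff_left by linarith
      qed
    qed
    then obtain \<delta> where \<delta>: "\<delta> > 0"
      "\<And>y. y \<noteq> x \<Longrightarrow> dist y x < \<delta> \<Longrightarrow> w \<bullet> (y - x) \<le> 2 * e * norm (y - x)"
      unfolding eventually_at by auto
    \<comment> \<open>The test point lies at distance \<open>\<delta> / 2\<close> from
      \<open>x\<close>.\<close>
    define t where "t = \<delta> / (2 * norm w)"
    have t: "t > 0" using \<delta> w by (simp add: t_def)
    have "w \<bullet> ((x + t *\<^sub>R w) - x) \<le> 2 * e * norm ((x + t *\<^sub>R w) - x)"
    proof (rule \<delta>(2))
      show "x + t *\<^sub>R w \<noteq> x" using t w by auto
      show "dist (x + t *\<^sub>R w) x < \<delta>" using \<delta>(1) w by (simp add: dist_norm t_def)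
    qed
    then have "t * (norm w)\<^sup>2 \<le> t * (2 * e * norm w)"
      using t by (simp add: power2_norm_eq_inner)
    then have "norm w * norm w \<le> (2 * e) * norm w" using t by (simp add: power2_eq_square)
    then have "norm w \<le> 2 * e" using w mult_le_cancel_right_pos by blast
    then show False using w by (simp add: e_def)
  qed
  ultimately show ?thesis by blast
qed

text \<open>An approximating sequence eventually enters the open interior, where its Frechet
  subgradients are forced to be gradients; continuity of \<open>g\<close> then identifies their
  limit.\<close>

lemma limiting_subdiff_eq_gradient:
  fixes \<psi> :: "'a::euclidean_space \<Rightarrow> ereal"
  assumes proper: "proper_fun \<psi>" and x: "x \<in> interior (eff_dom \<psi>)"
    and deriv: "\<And>z. z \<in> interior (eff_dom \<psi>) \<Longrightarrow> GDERIV (\<lambda>y. real_of_ereal (\<psi> y)) z :> g z"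
    and cont: "isCont g x"
  shows "limiting_subdiff \<psi> x = {g x}"
proof -
  have fr: "frechet_subdiff \<psi> z = {g z}" if "z \<in> interior (eff_dom \<psi>)" for z
    using frechet_subdiff_eq_gradient[OF proper that deriv[OF that]] .
  have xd: "x \<in> eff_dom \<psi>" using x interior_subset by auto
  have "\<exists>xs vs. xs \<longlonglongrightarrow> x \<and> (\<lambda>n. \<psi> (xs n)) \<longlonglongrightarrow> \<psi> x \<and>
      (\<forall>n. vs n \<in> frechet_subdiff \<psi> (xs n)) \<and> vs \<longlonglongrightarrow> g x"
    by (rule exI[of _ "\<lambda>_. x"], rule exI[of _ "\<lambda>_. g x"]) (simp add: fr[OF x])
  then have "g x \<in> limiting_subdiff \<psi> x"
    using xd by (simp add: limiting_subdiff_def)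
  moreover have "v = g x" if v: "v \<in> limiting_subdiff \<psi> x" for v
  proof -
    obtain xs vs where xs: "xs \<longlonglongrightarrow> x" "\<And>n. vs n \<in> frechet_subdiff \<psi> (xs n)" "vs \<longlonglongrightarrow> v"
      using v unfolding limiting_subdiff_def by auto
    have "eventually (\<lambda>n. xs n \<in> interior (eff_dom \<psi>)) sequentially"
      using topological_tendstoD[OF xs(1) open_interior x] .
    then have "eventually (\<lambda>n. g (xs n) = vs n) sequentially"
      by (rule eventually_mono) (metis fr xs(2) singletonD)
    moreover have "(\<lambda>n. g (xs n)) \<longlonglongrightarrow> g x"
      using isCont_tendsto_compose[OF cont xs(1)] .
    ultimately have "vs \<longlonglongrightarrow> g x" by (rule Lim_transform_eventually[rotated])
    then show ?thesis using xs(3) LIMSEQ_unique by blast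
  qed
  ultimately show ?thesis by blast
qed

section \<open>Proximal points and quadratic minorants\<close>

text \<open>Expanding the square around the forward step leaves
  \<open>\<gamma> / 2 * (norm v)\<^sup>2\<close>, which does not depend on the competitor and
  cancels. A forward-backward step thus minimizes \<open>\<phi>\<close> plus a linear term plus a
  proximal term centred at \<open>x\<close>.\<close>

lemma mem_prox_iff:
  fixes \<phi> :: "'a::real_inner \<Rightarrow> ereal"
  assumes proper: "proper_fun \<phi>" and \<gamma>: "\<gamma> > 0"
  shows "p \<in> prox \<gamma> \<phi> (x - \<gamma> *\<^sub>R v) \<longleftrightarrow> p \<in> eff_dom \<phi> \<and>
    (\<forall>z\<in>eff_dom \<phi>. real_of_ereal (\<phi> p) + v \<bullet> (p - x) + (norm (p - x))\<^sup>2 / (2 * \<gamma>) \<le>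
      real_of_ereal (\<phi> z) + v \<bullet> (z - x) + (norm (z - x))\<^sup>2 / (2 * \<gamma>))"
proof -
  define q where "q z = 1 / (2 * \<gamma>) * (norm (z - (x - \<gamma> *\<^sub>R v)))\<^sup>2" for z
  define h where "h z = real_of_ereal (\<phi> z) + v \<bullet> (z - x) + (norm (z - x))\<^sup>2 / (2 * \<gamma>)" for z
  have q: "q z = v \<bullet> (z - x) + (norm (z - x))\<^sup>2 / (2 * \<gamma>) + \<gamma> / 2 * (norm v)\<^sup>2" for z
  proof -
    have "z - (x - \<gamma> *\<^sub>R v) = (z - x) + \<gamma> *\<^sub>R v" by simp
    then have "(norm (z - (x - \<gamma> *\<^sub>R v)))\<^sup>2 =
        (norm (z - x))\<^sup>2 + 2 * \<gamma> * (v \<bullet> (z - x)) + \<gamma>\<^sup>2 * (norm v)\<^sup>2"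
      by (simp only: power2_norm_eq_inner)
        (simp add: inner_add_left inner_add_right inner_commute power2_eq_square algebra_simps)
    then show ?thesis using \<gamma> unfolding q_def by (simp add: field_simps power2_eq_square)
  qed
  have fin: "\<phi> z + ereal (q z) = ereal (h z + \<gamma> / 2 * (norm v)\<^sup>2)" if "z \<in> eff_dom \<phi>" for z
    by (subst eff_dom_ereal_real[OF proper that]) (simp add: q h_def)
  have inf: "\<phi> z + ereal (q z) = \<infinity>" if "z \<notin> eff_dom \<phi>" for z
    using that by (simp add: not_in_eff_dom)
  have "p \<in> prox \<gamma> \<phi> (x - \<gamma> *\<^sub>R v) \<longleftrightarrow> (\<forall>z. \<phi> p + ereal (q p) \<le> \<phi> z + ereal (q z))"
    unfolding prox_def is_arg_min_linorder q_def by simp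
  also have "\<dots> \<longleftrightarrow> p \<in> eff_dom \<phi> \<and> (\<forall>z\<in>eff_dom \<phi>. h p \<le> h z)"
  proof (intro iffI conjI ballI allI)
    assume min: "\<forall>z. \<phi> p + ereal (q p) \<le> \<phi> z + ereal (q z)"
    \<comment> \<open>One competitor with finite value forces the minimal value to be
      finite.\<close>
    obtain z0 where "z0 \<in> eff_dom \<phi>" using proper by (auto simp: proper_fun_def)
    then show p: "p \<in> eff_dom \<phi>" using min fin inf
      by (metis ereal_infty_less_eq(1) ereal.distinct(1) infinity_ereal_def)
    show "h p \<le> h z" if "z \<in> eff_dom \<phi>" for z
      using min[rule_format, of z] fin[OF p] fin[OF that] by simp
  next
    fix z
    assume "p \<in> eff_dom \<phi> \<and> (\<forall>z\<in>eff_dom \<phi>. h p \<le> h z)"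
    then show "\<phi> p + ereal (q p) \<le> \<phi> z + ereal (q z)"
      using fin inf by (cases "z \<in> eff_dom \<phi>") auto
  qed
  finally show ?thesis unfolding h_def .
qed

lemma prox_bounded_imp_quadratic_minorant:
  assumes "prox_bounded \<phi> \<gamma>\<^sub>\<phi>" "0 < \<gamma>" "ereal \<gamma> < \<gamma>\<^sub>\<phi>" "proper_fun \<phi>"
  obtains m where "\<And>z. z \<in> eff_dom \<phi> \<Longrightarrow> m - (norm z)\<^sup>2 / (2 * \<gamma>) \<le> real_of_ereal (\<phi> z)"
proof -
  obtain m where m: "\<And>z. ereal m \<le> \<phi> z + ereal (1 / (2 * \<gamma>) * (norm z)\<^sup>2)"
    using assms unfolding prox_bounded_def by blast
  have "m - (norm z)\<^sup>2 / (2 * \<gamma>) \<le> real_of_ereal (\<phi> z)" if z: "z \<in> eff_dom \<phi>" for z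
  proof -
    obtain a where "\<phi> z = ereal a" using eff_dom_ereal_real[OF assms(4) z] by blast
    then show ?thesis using m[of z] by simp
  qed
  then show thesis using that by blast
qed

text \<open>Far from \<open>x\<close>, prox-boundedness keeps \<open>\<phi>\<close> above a fixed
  quadratic. There \<open>norm (z - x)\<close> is at least \<open>\<delta>\<close>, so constant and
  linear terms are dominated by multiples of the squared distance, and a large enough curvature
  makes the minorant global.\<close>

lemma local_quadratic_minorant_imp_mem_prox:
  fixes \<phi> :: "'a::real_inner \<Rightarrow> ereal"
  assumes proper: "proper_fun \<phi>" and x: "x \<in> eff_dom \<phi>"
    and pb: "prox_bounded \<phi> \<gamma>\<^sub>\<phi>" and \<gamma>t: "0 < \<gamma>t" "ereal \<gamma>t < \<gamma>\<^sub>\<phi>"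
    and \<delta>: "\<delta> > 0"
    and loc: "\<And>z. z \<in> eff_dom \<phi> \<Longrightarrow> z \<in> ball x \<delta> \<Longrightarrow>
      real_of_ereal (\<phi> x) \<le> real_of_ereal (\<phi> z) + v \<bullet> (z - x) + C * (norm (z - x))\<^sup>2"
  obtains \<gamma> where "0 < \<gamma>" "\<gamma> \<le> \<gamma>t" "x \<in> prox \<gamma> \<phi> (x - \<gamma> *\<^sub>R v)"
proof -
  obtain m where m: "\<And>z. z \<in> eff_dom \<phi> \<Longrightarrow> m - (norm z)\<^sup>2 / (2 * \<gamma>t) \<le> real_of_ereal (\<phi> z)"
    using prox_bounded_imp_quadratic_minorant[OF pb \<gamma>t proper] by blast
  define r where "r = real_of_ereal (\<phi> x)"
  define B where "B = \<bar>r - m + (norm x)\<^sup>2 / \<gamma>t\<bar>"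
  \<comment> \<open>The first summand serves inside the ball. Outside it, the others absorb in turn
    the quadratic from prox-boundedness, the linear term and the constant \<open>B\<close>.\<close>
  define K where "K = \<bar>C\<bar> + 1 / \<gamma>t + norm v / \<delta> + B / \<delta>\<^sup>2"
  have "0 < 1 / \<gamma>t" "0 \<le> norm v / \<delta>" "0 \<le> B / \<delta>\<^sup>2"
    using \<gamma>t(1) \<delta> by (auto simp: B_def)
  then have Kpos: "K \<ge> 1 / \<gamma>t" "K \<ge> C" "K > 0"
    unfolding K_def by linarith+
  \<comment> \<open>The proximal term then has coefficient exactly \<open>K\<close>, and the summand
    \<open>1 / \<gamma>t\<close> of \<open>K\<close> keeps the step size below
    \<open>\<gamma>t\<close>.\<close>
  define \<gamma> where "\<gamma> = 1 / (2 * K)"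
  have \<gamma>: "0 < \<gamma>" using Kpos by (simp add: \<gamma>_def)
  have "\<gamma> \<le> \<gamma>t"
  proof -
    have "1 \<le> K * \<gamma>t" using Kpos(1) \<gamma>t(1) by (simp add: pos_divide_le_eq)
    also have "\<dots> \<le> \<gamma>t * (2 * K)" using Kpos \<gamma>t(1) by simp
    finally show ?thesis using Kpos by (simp add: \<gamma>_def pos_divide_le_eq)
  qed
  have main: "r \<le> real_of_ereal (\<phi> z) + v \<bullet> (z - x) + K * (norm (z - x))\<^sup>2"
    if z: "z \<in> eff_dom \<phi>" for z
  proof (cases "z \<in> ball x \<delta>")
    case True
    have "C * (norm (z - x))\<^sup>2 \<le> K * (norm (z - x))\<^sup>2"
      using Kpos by (intro mult_right_mono) auto
    then show ?thesis using loc[OF z True] by (simp add: r_def)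
  next
    case False
    define n where "n = norm (z - x)"
    have n: "\<delta> \<le> n" using False by (simp add: n_def dist_norm norm_minus_commute)
    have "norm z \<le> norm x + n" unfolding n_def by (metis add.commute norm_diff_triangle_ineq diff_add_cancel norm_triangle_sub)
    then have "(norm z)\<^sup>2 \<le> (norm x + n)\<^sup>2" by (intro power_mono) auto
    also have "\<dots> \<le> 2 * (norm x)\<^sup>2 + 2 * n\<^sup>2"
      using zero_le_power2[of "norm x - n"] by (simp add: power2_eq_square algebra_simps)
    finally have "(norm z)\<^sup>2 / (2 * \<gamma>t) \<le> (2 * (norm x)\<^sup>2 + 2 * n\<^sup>2) / (2 * \<gamma>t)"
      using \<gamma>t(1) by (intro divide_right_mono) auto
    also have "\<dots> = (norm x)\<^sup>2 / \<gamma>t + 1 / \<gamma>t * n\<^sup>2" using \<gamma>t(1) by (simp add: field_simps)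
    finally have 1: "m - (norm x)\<^sup>2 / \<gamma>t - 1 / \<gamma>t * n\<^sup>2 \<le> real_of_ereal (\<phi> z)"
      using m[OF z] by linarith
    have "- (v \<bullet> (z - x)) \<le> norm v * n"
      using Cauchy_Schwarz_ineq2[of v "z - x"] by (simp add: n_def)
    also have "\<dots> \<le> norm v / \<delta> * n\<^sup>2"
    proof -
      have "norm v * n * \<delta> \<le> norm v * n * n"
        using n \<delta> by (intro mult_left_mono) auto
      then show ?thesis using \<delta> by (simp add: field_simps power2_eq_square)
    qed
    finally have 2: "- (v \<bullet> (z - x)) \<le> norm v / \<delta> * n\<^sup>2" .
    have "B * \<delta>\<^sup>2 \<le> B * n\<^sup>2"
      using n \<delta> by (intro mult_left_mono power_mono) (auto simp: B_def)
    then have "B \<le> B / \<delta>\<^sup>2 * n\<^sup>2" using \<delta> by (simp add: field_simps)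
    then have 3: "r - m + (norm x)\<^sup>2 / \<gamma>t \<le> B / \<delta>\<^sup>2 * n\<^sup>2" by (simp add: B_def)
    have 4: "0 \<le> \<bar>C\<bar> * n\<^sup>2" by simp
    have "K * n\<^sup>2 = \<bar>C\<bar> * n\<^sup>2 + 1 / \<gamma>t * n\<^sup>2 + norm v / \<delta> * n\<^sup>2 + B / \<delta>\<^sup>2 * n\<^sup>2"
      unfolding K_def by (simp only: distrib_right)
    then show ?thesis using 1 2 3 4 unfolding n_def[symmetric] by linarith
  qed
  have "x \<in> prox \<gamma> \<phi> (x - \<gamma> *\<^sub>R v)"
    unfolding mem_prox_iff[OF proper \<gamma>] using x main Kpos(3) by (simp add: r_def \<gamma>_def mult.commute)
  then show thesis using that \<gamma> \<open>\<gamma> \<le> \<gamma>t\<close> by blast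
qed

section \<open>Proximal stationarity of the sum and minorants of \<open>\<phi>\<close>\<close>

lemma residual_nonneg: "0 \<le> residual F \<phi> \<gamma> x"
  unfolding residual_def by (auto intro!: Inf_greatest)

text \<open>Subtracting the expansion of \<open>F\<close> at \<open>x\<close> from the stationarity
  inequality leaves a local quadratic minorant of \<open>\<phi>\<close> with slope
  \<open>- g x\<close>; the error of the expansion only raises the curvature by
  \<open>L\<close>.\<close>

lemma prox_stationary_imp_mem_prox:
  fixes F \<phi> :: "'a::euclidean_space \<Rightarrow> ereal"
  assumes F: "proper_fun F" and \<phi>: "proper_fun \<phi>"
    and dom: "eff_dom \<phi> \<subseteq> interior (eff_dom F)"
    and deriv: "\<And>z. z \<in> interior (eff_dom F) \<Longrightarrow> GDERIV (\<lambda>y. real_of_ereal (F y)) z :> g z"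
    and lip: "locally_lipschitz_at (interior (eff_dom F)) g x"
    and pb: "prox_bounded \<phi> \<gamma>\<^sub>\<phi>" and \<gamma>t: "0 < \<gamma>t" "ereal \<gamma>t < \<gamma>\<^sub>\<phi>"
    and stat: "prox_stationary F \<phi> x"
  obtains \<gamma> where "0 < \<gamma>" "\<gamma> \<le> \<gamma>t" "x \<in> prox \<gamma> \<phi> (x - \<gamma> *\<^sub>R g x)"
proof -
  have x: "x \<in> eff_dom \<phi>" using stat by (simp add: prox_stationary_def)
  obtain \<gamma>0 \<delta>0 where s: "\<gamma>0 > 0" "\<delta>0 > 0" "\<And>y. y \<in> ball x \<delta>0 \<Longrightarrow>
      F y + \<phi> y \<ge> F x + \<phi> x - ereal (1 / (2 * \<gamma>0) * (norm (y - x))\<^sup>2)"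
    using stat unfolding prox_stationary_def prox_subdiff_def by (auto simp flip: zero_ereal_def)
  obtain L \<delta>1 where L: "L > 0" "\<delta>1 > 0" "ball x \<delta>1 \<subseteq> interior (eff_dom F)"
    "\<And>y. y \<in> ball x \<delta>1 \<Longrightarrow> \<bar>real_of_ereal (F y) - real_of_ereal (F x) - g x \<bullet> (y - x)\<bar>
      \<le> L * (norm (y - x))\<^sup>2"
    using GDERIV_lipschitz_quadratic_bound[OF deriv lip] by metis
  show thesis
  proof (rule local_quadratic_minorant_imp_mem_prox[OF \<phi> x pb \<gamma>t])
    show "min \<delta>0 \<delta>1 > 0" using s L by simp
    show "real_of_ereal (\<phi> x) \<le> real_of_ereal (\<phi> z) + g x \<bullet> (z - x) +
        (L + 1 / (2 * \<gamma>0)) * (norm (z - x))\<^sup>2"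
      if z: "z \<in> eff_dom \<phi>" and zb: "z \<in> ball x (min \<delta>0 \<delta>1)" for z
    proof -
      have "z \<in> eff_dom F" "x \<in> eff_dom F" using z x dom interior_subset by auto
      then obtain Fz Fx pz px where e: "F z = ereal Fz" "F x = ereal Fx" "\<phi> z = ereal pz" "\<phi> x = ereal px"
        using eff_dom_ereal_real[OF F] eff_dom_ereal_real[OF \<phi>] z x by metis
      have "Fz + pz \<ge> Fx + px - 1 / (2 * \<gamma>0) * (norm (z - x))\<^sup>2"
        using s(3)[of z] zb e by simp
      moreover have "\<bar>Fz - Fx - g x \<bullet> (z - x)\<bar> \<le> L * (norm (z - x))\<^sup>2"
        using L(4)[of z] zb e by simp
      ultimately show ?thesis unfolding e by (simp add: distrib_right)
    qed
  qed (rule that)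
qed

text \<open>The reverse computation: adding the expansion of \<open>F\<close> to the minorant of
  \<open>\<phi>\<close> cancels the linear terms and adds up the curvatures.\<close>

lemma quadratic_minorant_imp_prox_stationary:
  fixes F \<phi> :: "'a::euclidean_space \<Rightarrow> ereal"
  assumes F: "proper_fun F" and \<phi>: "proper_fun \<phi>"
    and dom: "eff_dom \<phi> \<subseteq> interior (eff_dom F)"
    and deriv: "\<And>z. z \<in> interior (eff_dom F) \<Longrightarrow> GDERIV (\<lambda>y. real_of_ereal (F y)) z :> g z"
    and lip: "locally_lipschitz_at (interior (eff_dom F)) g x"
    and x: "x \<in> eff_dom \<phi>" and C: "C > 0"
    and minor: "\<And>z. z \<in> eff_dom \<phi> \<Longrightarrow>
      real_of_ereal (\<phi> x) \<le> real_of_ereal (\<phi> z) + g x \<bullet> (z - x) + C * (norm (z - x))\<^sup>2"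
  shows "prox_stationary F \<phi> x"
proof -
  obtain L \<delta> where L: "L > 0" "\<delta> > 0" "ball x \<delta> \<subseteq> interior (eff_dom F)"
    "\<And>y. y \<in> ball x \<delta> \<Longrightarrow> \<bar>real_of_ereal (F y) - real_of_ereal (F x) - g x \<bullet> (y - x)\<bar>
      \<le> L * (norm (y - x))\<^sup>2"
    using GDERIV_lipschitz_quadratic_bound[OF deriv lip] by metis
  have xF: "x \<in> eff_dom F" using x dom interior_subset by auto
  obtain Fx px where ex: "F x = ereal Fx" "\<phi> x = ereal px"
    using eff_dom_ereal_real[OF F xF] eff_dom_ereal_real[OF \<phi> x] by blast
  define \<gamma> where "\<gamma> = 1 / (2 * (L + C))"
  have \<gamma>: "\<gamma> > 0" "1 / (2 * \<gamma>) = L + C" using L C by (auto simp: \<gamma>_def)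
  have "F y + \<phi> y \<ge> F x + \<phi> x + ereal (0 \<bullet> (y - x)) - ereal (1 / (2 * \<gamma>) * (norm (y - x))\<^sup>2)"
    if y: "y \<in> ball x \<delta>" for y
  proof (cases "y \<in> eff_dom \<phi>")
    case True
    then have yF: "y \<in> eff_dom F" using dom interior_subset by auto
    obtain Fy py where ey: "F y = ereal Fy" "\<phi> y = ereal py"
      using eff_dom_ereal_real[OF F yF] eff_dom_ereal_real[OF \<phi> True] by blast
    show ?thesis
      using L(4)[OF y] minor[OF True] unfolding \<gamma>(2) ex ey by (simp add: distrib_right)
  next
    case False
    \<comment> \<open>\<open>F\<close> never takes the value -\<infinity>, so outside the domain of
      \<open>\<phi>\<close> the sum is +\<infinity> and the inequality is trivial.\<close>
    then have "F y + \<phi> y = \<infinity>"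
      using F by (simp add: not_in_eff_dom proper_fun_def)
    then show ?thesis by (simp only: ereal_less_eq)
  qed
  moreover have "x \<in> eff_dom (\<lambda>y. F y + \<phi> y)" using ex by (simp add: eff_dom_def)
  ultimately show ?thesis
    unfolding prox_stationary_def prox_subdiff_def using x \<gamma>(1) L(2) by blast
qed

section \<open>Limits of proximal points\<close>

lemma lower_semicontinuous_sequentially_le:
  fixes \<phi> :: "'a::metric_space \<Rightarrow> ereal"
  assumes lsc: "lower_semicontinuous \<phi>" and ps: "ps \<longlonglongrightarrow> x"
    and le: "\<And>n. \<phi> (ps n) \<le> ereal (r n)" and r: "r \<longlonglongrightarrow> R"
  shows "\<phi> x \<le> ereal R"
proof (rule ccontr)
  assume "\<not> \<phi> x \<le> ereal R"
  then obtain c where c: "ereal R < ereal c" "ereal c < \<phi> x"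
    using ereal_dense2 by (metis not_le)
  have "\<phi> x \<le> Liminf (at x) \<phi>" using lsc by (simp add: lower_semicontinuous_def)
  then have "eventually (\<lambda>y. ereal c < \<phi> y) (at x)" using c(2) by (simp add: le_Liminf_iff)
  \<comment> \<open>The filter \<open>at x\<close> omits \<open>x\<close>, but \<open>ps\<close> may
    hit it; since \<open>c\<close> lies below \<open>\<phi> x\<close>, the full neighbourhood is
    covered.\<close>
  then have "eventually (\<lambda>y. ereal c < \<phi> y) (nhds x)"
    using c(2) by (auto simp: eventually_at_filter elim: eventually_mono)
  then have "eventually (\<lambda>n. ereal c < \<phi> (ps n)) sequentially"
    using ps eventually_compose_filterlim by blast
  moreover have "eventually (\<lambda>n. r n < c) sequentially"
    using order_tendstoD(2)[OF r] c(1) by simp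
  ultimately have "eventually (\<lambda>n. False) sequentially"
  proof eventually_elim
    case (elim n)
    have "ereal c < ereal (r n)" using elim(1) le[of n] by (rule less_le_trans)
    then show ?case using elim(2) by simp
  qed
  then show False by simp
qed

text \<open>
  Expanding the square in the proximal inequality separates the step size from the gradient
  term, so \<open>\<gamma>s n\<close> can be replaced by its lower bound before passing to the limit
  and need not converge.
\<close>

lemma prox_limit_minorant:
  fixes \<phi> :: "'a::euclidean_space \<Rightarrow> ereal"
  assumes \<phi>: "proper_fun \<phi>" and lsc: "lower_semicontinuous \<phi>"
    and xs: "xs \<longlonglongrightarrow> x" and vs: "vs \<longlonglongrightarrow> v" and ps: "ps \<longlonglongrightarrow> x"
    and \<gamma>low: "0 < \<gamma>low" "\<And>n. \<gamma>low \<le> \<gamma>s n"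
    and prox: "\<And>n. ps n \<in> prox (\<gamma>s n) \<phi> (xs n - \<gamma>s n *\<^sub>R vs n)"
    and x: "x \<in> eff_dom \<phi>" and z: "z \<in> eff_dom \<phi>"
  shows "real_of_ereal (\<phi> x) \<le> real_of_ereal (\<phi> z) + v \<bullet> (z - x) + 1 / (2 * \<gamma>low) * (norm (z - x))\<^sup>2"
proof -
  define r where "r n = real_of_ereal (\<phi> z) + vs n \<bullet> (z - xs n) +
    1 / (2 * \<gamma>low) * (norm (z - xs n))\<^sup>2 - vs n \<bullet> (ps n - xs n)" for n
  have "\<phi> (ps n) \<le> ereal (r n)" for n
  proof -
    have \<gamma>: "0 < \<gamma>s n" using \<gamma>low(1) \<gamma>low(2)[of n] by linarith
    have p: "ps n \<in> eff_dom \<phi>" and le: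
      "real_of_ereal (\<phi> (ps n)) + vs n \<bullet> (ps n - xs n) + (norm (ps n - xs n))\<^sup>2 / (2 * \<gamma>s n) \<le>
       real_of_ereal (\<phi> z) + vs n \<bullet> (z - xs n) + (norm (z - xs n))\<^sup>2 / (2 * \<gamma>s n)"
      using prox[of n] z unfolding mem_prox_iff[OF \<phi> \<gamma>] by auto
    have "(norm (z - xs n))\<^sup>2 / (2 * \<gamma>s n) \<le> (norm (z - xs n))\<^sup>2 / (2 * \<gamma>low)"
      using \<gamma>low(1) \<gamma>low(2)[of n] by (intro divide_left_mono) auto
    moreover have "0 \<le> (norm (ps n - xs n))\<^sup>2 / (2 * \<gamma>s n)" using \<gamma> by simp
    ultimately have "real_of_ereal (\<phi> (ps n)) \<le> r n" using le by (simp add: r_def)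
    then show ?thesis by (subst eff_dom_ereal_real[OF \<phi> p]) simp
  qed
  moreover have "r \<longlonglongrightarrow> real_of_ereal (\<phi> z) + v \<bullet> (z - x) +
      1 / (2 * \<gamma>low) * (norm (z - x))\<^sup>2 - v \<bullet> (x - x)"
    unfolding r_def by (intro tendsto_intros xs vs ps)
  ultimately have "\<phi> x \<le> ereal (real_of_ereal (\<phi> z) + v \<bullet> (z - x) +
      1 / (2 * \<gamma>low) * (norm (z - x))\<^sup>2 - v \<bullet> (x - x))"
    by (rule lower_semicontinuous_sequentially_le[OF lsc ps])
  then show ?thesis by (subst (asm) eff_dom_ereal_real[OF \<phi> x]) simp
qed

text \<open>A zero lower limit yields arbitrarily late indices with tiny residual, and at each a
  proximal point nearly attaining the infimum. Multiplying by the step size, at most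
  \<open>\<gamma>t\<close>, turns a small residual into a small distance to the iterate.\<close>

lemma liminf_residual_zero_obtains:
  fixes F \<phi> :: "'a::euclidean_space \<Rightarrow> ereal"
  assumes lim: "liminf (\<lambda>n. residual F \<phi> (\<gamma>s n) (xs n)) = 0"
    and sub: "\<And>n. limiting_subdiff F (xs n) = {g (xs n)}"
    and \<gamma>: "\<And>n. 0 < \<gamma>s n" "\<And>n. \<gamma>s n \<le> \<gamma>t" and xs: "xs \<longlonglongrightarrow> x"
  obtains s ps where "filterlim s at_top sequentially" "ps \<longlonglongrightarrow> x"
    "\<And>k. ps k \<in> prox (\<gamma>s (s k)) \<phi> (xs (s k) - \<gamma>s (s k) *\<^sub>R g (xs (s k)))"
proof -
  have "\<exists>n\<ge>k. \<exists>p. p \<in> prox (\<gamma>s n) \<phi> (xs n - \<gamma>s n *\<^sub>R g (xs n)) \<and>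
      norm (xs n - p) \<le> \<gamma>t / real (Suc k)" for k
  proof -
    have "\<exists>n\<ge>k. residual F \<phi> (\<gamma>s n) (xs n) < ereal (1 / real (Suc k))"
    proof (rule ccontr)
      assume "\<not> ?thesis"
      then have "eventually (\<lambda>n. ereal (1 / real (Suc k)) \<le> residual F \<phi> (\<gamma>s n) (xs n)) sequentially"
        by (auto simp: eventually_sequentially not_less)
      then have "ereal (1 / real (Suc k)) \<le> liminf (\<lambda>n. residual F \<phi> (\<gamma>s n) (xs n))"
        by (rule Liminf_bounded)
      then show False unfolding lim by simp
    qed
    then obtain n where n: "n \<ge> k" "residual F \<phi> (\<gamma>s n) (xs n) < ereal (1 / real (Suc k))" by blast
    then obtain p where p: "p \<in> prox (\<gamma>s n) \<phi> (xs n - \<gamma>s n *\<^sub>R g (xs n))"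
      "norm ((xs n - p) /\<^sub>R \<gamma>s n) < 1 / real (Suc k)"
      unfolding residual_def Inf_less_iff sub by auto
    have "norm (xs n - p) / \<gamma>s n < 1 / real (Suc k)"
      using p(2) \<gamma>(1)[of n] by (simp add: divide_inverse mult.commute)
    then have "norm (xs n - p) \<le> 1 / real (Suc k) * \<gamma>s n"
      using \<gamma>(1)[of n] by (simp only: pos_divide_less_eq less_imp_le)
    also have "\<dots> \<le> 1 / real (Suc k) * \<gamma>t" using \<gamma>(2) by (intro mult_left_mono) auto
    finally show ?thesis using n(1) p(1) by auto
  qed
  \<comment> \<open>The index map need not be strictly increasing; \<open>s k \<ge> k\<close>
    suffices for it to tend to infinity.\<close>
  then obtain s ps where s: "\<And>k. s k \<ge> k"
    "\<And>k. ps k \<in> prox (\<gamma>s (s k)) \<phi> (xs (s k) - \<gamma>s (s k) *\<^sub>R g (xs (s k)))"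
    "\<And>k. norm (xs (s k) - ps k) \<le> \<gamma>t / real (Suc k)"
    by metis
  have top: "filterlim s at_top sequentially"
    by (rule filterlim_at_top_mono[OF filterlim_ident]) (use s(1) in auto)
  have "(\<lambda>k. \<gamma>t / real (Suc k)) \<longlonglongrightarrow> 0"
    by (rule LIMSEQ_Suc[OF lim_const_over_n])
  then have "(\<lambda>k. xs (s k) - ps k) \<longlonglongrightarrow> 0"
    by (rule Lim_null_comparison[rotated]) (use s(3) in auto)
  then have "(\<lambda>k. xs (s k) - (xs (s k) - ps k)) \<longlonglongrightarrow> x - 0"
    by (intro tendsto_diff filterlim_compose[OF xs top])
  then show thesis using that[OF top _ s(2)] by simp
qed

section \<open>The two implications of the equivalence\<close>

theorem theorem3p14:
  fixes F \<phi> :: "'a::euclidean_space \<Rightarrow> ereal"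
    and \<gamma>\<^sub>\<phi> :: ereal and \<gamma>t :: real and xstar :: 'a
  assumes F_proper: "proper_fun F" and F_lsc: "lower_semicontinuous F"
    and phi_proper: "proper_fun \<phi>" and phi_lsc: "lower_semicontinuous \<phi>"
    and bounded_below: "(INF x. F x + \<phi> x) > -\<infinity>"
    and F_lipschitz: "\<And>x. x \<in> interior (eff_dom F) \<Longrightarrow>
          locally_lipschitz_at (interior (eff_dom F)) (\<lambda>y. real_of_ereal (F y)) x"
    and dom_convex: "convex (eff_dom F)"
    and dom_subset: "eff_dom \<phi> \<subseteq> interior (eff_dom F)"
    and phi_prox_bounded: "prox_bounded \<phi> \<gamma>\<^sub>\<phi>"
    and F_differentiable: "\<And>x. x \<in> interior (eff_dom F) \<Longrightarrow>
          (\<lambda>y. real_of_ereal (F y)) differentiable (at x)"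
    and gradient_lipschitz: "\<And>x. x \<in> interior (eff_dom F) \<Longrightarrow>
          locally_lipschitz_at (interior (eff_dom F)) (gradient F) x"
    and gt_range: "0 < \<gamma>t" "ereal \<gamma>t < \<gamma>\<^sub>\<phi>"
    and xstar_dom: "xstar \<in> eff_dom \<phi>"
  shows "prox_stationary F \<phi> xstar \<longleftrightarrow>
    (\<exists>(xs :: nat \<Rightarrow> 'a) (\<gamma>s :: nat \<Rightarrow> real) \<gamma>low.
        range xs \<subseteq> interior (eff_dom F) \<and> xs \<longlonglongrightarrow> xstar \<and>
        \<gamma>low \<in> {0<..\<gamma>t} \<and> range \<gamma>s \<subseteq> {\<gamma>low..\<gamma>t} \<and>
        liminf (\<lambda>n. residual F \<phi> (\<gamma>s n) (xs n)) = 0)"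
proof
  let ?D = "interior (eff_dom F)"
  let ?g = "gradient F"
  have deriv: "GDERIV (\<lambda>y. real_of_ereal (F y)) z :> ?g z" if "z \<in> ?D" for z
    using F_differentiable[OF that] by (rule GDERIV_gradient)
  \<comment> \<open>This fixes the subgradient in the residual, so that its infimum runs over
    proximal points only.\<close>
  have sub: "limiting_subdiff F z = {?g z}" if "z \<in> ?D" for z
    using limiting_subdiff_eq_gradient[OF F_proper that deriv]
      locally_lipschitz_at_isCont[OF gradient_lipschitz[OF that]] by blast
  have xD: "xstar \<in> ?D" using xstar_dom dom_subset by blast
  note lip = gradient_lipschitz[OF xD]
  {
    assume stat: "prox_stationary F \<phi> xstar"
    obtain \<gamma> where \<gamma>: "0 < \<gamma>" "\<gamma> \<le> \<gamma>t" "xstar \<in> prox \<gamma> \<phi> (xstar - \<gamma> *\<^sub>R ?g xstar)"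
      using prox_stationary_imp_mem_prox[OF F_proper phi_proper dom_subset deriv lip
          phi_prox_bounded gt_range stat] by metis
    \<comment> \<open>\<open>xstar\<close> is its own proximal point, so it competes in the infimum
      with value 0.\<close>
    have "residual F \<phi> \<gamma> xstar \<le> ereal (norm ((xstar - xstar) /\<^sub>R \<gamma>))"
      unfolding residual_def using \<gamma>(3) sub[OF xD] by (intro Inf_lower) blast
    then have "residual F \<phi> \<gamma> xstar = 0"
      using residual_nonneg[of F \<phi> \<gamma> xstar] by (simp add: zero_ereal_def[symmetric])
    then have "liminf (\<lambda>n. residual F \<phi> \<gamma> xstar) = 0"
      by (simp add: Liminf_const)
    then show "\<exists>(xs :: nat \<Rightarrow> 'a) (\<gamma>s :: nat \<Rightarrow> real) \<gamma>low.
        range xs \<subseteq> ?D \<and> xs \<longlonglongrightarrow> xstar \<and> \<gamma>low \<in> {0<..\<gamma>t} \<and> range \<gamma>s \<subseteq> {\<gamma>low..\<gamma>t} \<and>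
        liminf (\<lambda>n. residual F \<phi> (\<gamma>s n) (xs n)) = 0"
      \<comment> \<open>Constant sequences are the witnesses, and the single step size is its own
        lower bound.\<close>
      using xD \<gamma> by (intro exI[of _ "\<lambda>_. xstar"] exI[of _ "\<lambda>_. \<gamma>"] exI[of _ \<gamma>]) auto
  next
    assume "\<exists>(xs :: nat \<Rightarrow> 'a) (\<gamma>s :: nat \<Rightarrow> real) \<gamma>low.
        range xs \<subseteq> ?D \<and> xs \<longlonglongrightarrow> xstar \<and> \<gamma>low \<in> {0<..\<gamma>t} \<and> range \<gamma>s \<subseteq> {\<gamma>low..\<gamma>t} \<and>
        liminf (\<lambda>n. residual F \<phi> (\<gamma>s n) (xs n)) = 0"
    then obtain xs :: "nat \<Rightarrow> 'a" and \<gamma>s :: "nat \<Rightarrow> real" and \<gamma>low where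
      xs: "range xs \<subseteq> ?D" "xs \<longlonglongrightarrow> xstar" and low: "\<gamma>low \<in> {0<..\<gamma>t}" "range \<gamma>s \<subseteq> {\<gamma>low..\<gamma>t}"
      and lim: "liminf (\<lambda>n. residual F \<phi> (\<gamma>s n) (xs n)) = 0"
      by blast
    have bnd: "0 < \<gamma>low" "\<gamma>low \<le> \<gamma>s n" "\<gamma>s n \<le> \<gamma>t" for n
      using low by (auto simp: image_subset_iff)
    have pos: "0 < \<gamma>s n" for n using bnd(1) bnd(2)[of n] by linarith
    have subs: "limiting_subdiff F (xs n) = {?g (xs n)}" for n
      using xs(1) by (intro sub) auto
    obtain s ps where s: "filterlim s at_top sequentially" "ps \<longlonglongrightarrow> xstar"
      "\<And>k. ps k \<in> prox (\<gamma>s (s k)) \<phi> (xs (s k) - \<gamma>s (s k) *\<^sub>R ?g (xs (s k)))"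
      using liminf_residual_zero_obtains[where g = ?g, OF lim subs pos bnd(3) xs(2)] by metis
    have xss: "(\<lambda>k. xs (s k)) \<longlonglongrightarrow> xstar" by (rule filterlim_compose[OF xs(2) s(1)])
    have gs: "(\<lambda>k. ?g (xs (s k))) \<longlonglongrightarrow> ?g xstar"
      by (rule isCont_tendsto_compose[OF locally_lipschitz_at_isCont[OF lip] xss])
    show "prox_stationary F \<phi> xstar"
    proof (rule quadratic_minorant_imp_prox_stationary[OF F_proper phi_proper dom_subset deriv lip xstar_dom])
      \<comment> \<open>The positive lower bound on the step sizes keeps the curvature of the
        limiting minorant finite.\<close>
      show "0 < 1 / (2 * \<gamma>low)" using bnd(1) by simp
      show "real_of_ereal (\<phi> xstar) \<le> real_of_ereal (\<phi> z) + ?g xstar \<bullet> (z - xstar) +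
          1 / (2 * \<gamma>low) * (norm (z - xstar))\<^sup>2" if "z \<in> eff_dom \<phi>" for z
        by (rule prox_limit_minorant[OF phi_proper phi_lsc xss gs s(2) bnd(1) bnd(2) s(3) xstar_dom that])
    qed
  }
qed

end
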